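(* Let $A>0$, $\gamma>1$ and $p(\rho)=A\rho^\gamma$. There exists $C^\infty$ initial data $(\tilde\rho_0,\tilde u_0):\mathbb{R}^2\to(0,\infty)\times\mathbb{R}^2$ for the two-dimensional isentropic compressible Euler equations $$\partial_t\rho+\mathrm{div}(\rho u)=0,\qquad\partial_tu+u\cdot\nabla u+\frac1\rho\nabla p=0,$$ such that there is a corresponding smooth solution $(\rho,u)$ on a time interval $[0,T]$ for some $T>0$ with a corresponding Lagrangian trajectory $X(\alpha,t)$ which is not analytic at $t=0$.
   Context: Here $(\rho,u)=(\rho(x,t),u(x,t))$ takes values in $(0,\infty)\times\mathbb{R}^2$ and $p=p(\rho)$. The Lagrangian trajectory starting at $\alpha\in\mathbb{R}^2$ is the solution of $\frac{dX}{dt}(\alpha,t)=u(X(\alpha,t),t)$, $X(\alpha,0)=\alpha$. Not analytic at $t=0$ means that $t\mapsto X(\alpha,t)$ does not coincide with a convergent power series in $t$ on any interval $[0,\eta)$, $\eta>0$. *)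

theory Defs
  imports "HOL-Analysis.Analysis"
begin

text \<open>
  \<open>C\<^sup>k\<close> on a set \<open>S\<close>, with derivatives taken within \<open>S\<close>. It is used only for \<open>S = UNIV\<close> and for the
  slab \<open>UNIV \<times> {0..T}\<close> with \<open>T > 0\<close>. In both cases derivatives within \<open>S\<close> are unique, and on the
  faces \<open>t = 0\<close> and \<open>t = T\<close> they are one-sided in time. Since the domain is finite-dimensional,
  it suffices to require that each directional derivative is \<open>C\<^sup>k\<close>.
\<close>

primrec Ck_on :: "nat \<Rightarrow> ('a::euclidean_space \<Rightarrow> 'b::real_normed_vector) \<Rightarrow> 'a set \<Rightarrow> bool" where
  "Ck_on 0 f S \<longleftrightarrow> continuous_on S f"
| "Ck_on (Suc k) f S \<longleftrightarrow>
     (\<exists>f'. (\<forall>x\<in>S. (f has_derivative f' x) (at x within S)) \<and> (\<forall>v. Ck_on k (\<lambda>x. f' x v) S))"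

definition smooth_on :: "('a::euclidean_space \<Rightarrow> 'b::real_normed_vector) \<Rightarrow> 'a set \<Rightarrow> bool" where
  "smooth_on f S \<longleftrightarrow> (\<forall>k. Ck_on k f S)"

text \<open>
  The operators below are total; they have their usual meaning where the argument is differentiable,
  which smoothness guarantees for every function they are applied to in the Euler equations.
\<close>

definition pderiv_x :: "'n::finite \<Rightarrow> (real ^ 'n \<Rightarrow> 'b::real_normed_vector) \<Rightarrow> real ^ 'n \<Rightarrow> 'b" where
  "pderiv_x j f x = frechet_derivative f (at x) (axis j 1)"

definition gradient :: "(real ^ 'n::finite \<Rightarrow> real) \<Rightarrow> real ^ 'n \<Rightarrow> real ^ 'n" where
  "gradient f x = (\<chi> j. pderiv_x j f x)"

definition divergence :: "(real ^ 'n::finite \<Rightarrow> real ^ 'n) \<Rightarrow> real ^ 'n \<Rightarrow> real" where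
  "divergence F x = (\<Sum>j\<in>UNIV. pderiv_x j F x $ j)"

definition advect ::
  "real ^ 'n::finite \<Rightarrow> (real ^ 'n \<Rightarrow> 'b::real_normed_vector) \<Rightarrow> real ^ 'n \<Rightarrow> 'b" where
  "advect v f x = (\<Sum>j\<in>UNIV. (v $ j) *\<^sub>R pderiv_x j f x)"

definition pderiv_t :: "real \<Rightarrow> (real \<Rightarrow> 'b::real_normed_vector) \<Rightarrow> real \<Rightarrow> 'b" where
  "pderiv_t T g t = vector_derivative g (at t within {0..T})"

definition smooth_euler_solution ::
  "(real \<Rightarrow> real) \<Rightarrow> real \<Rightarrow> (real ^ 2 \<Rightarrow> real \<Rightarrow> real) \<Rightarrow> (real ^ 2 \<Rightarrow> real \<Rightarrow> real ^ 2) \<Rightarrow> bool" where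
  "smooth_euler_solution p T \<rho> u \<longleftrightarrow>
     smooth_on (\<lambda>(x, t). \<rho> x t) (UNIV \<times> {0..T}) \<and>
     smooth_on (\<lambda>(x, t). u x t) (UNIV \<times> {0..T}) \<and>
     (\<forall>x. \<forall>t\<in>{0..T}. \<rho> x t > 0) \<and>
     (\<forall>x. \<forall>t\<in>{0..T}.
        pderiv_t T (\<rho> x) t + divergence (\<lambda>y. \<rho> y t *\<^sub>R u y t) x = 0 \<and>
        pderiv_t T (u x) t + advect (u x t) (\<lambda>y. u y t) x
          + (1 / \<rho> x t) *\<^sub>R gradient (\<lambda>y. p (\<rho> y t)) x = 0)"

definition lagrangian_trajectory ::
  "real \<Rightarrow> (real ^ 'n::finite \<Rightarrow> real \<Rightarrow> real ^ 'n) \<Rightarrow> real ^ 'n \<Rightarrow> (real \<Rightarrow> real ^ 'n) \<Rightarrow> bool" where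
  "lagrangian_trajectory T u \<alpha> X \<longleftrightarrow>
     X 0 = \<alpha> \<and> (\<forall>t\<in>{0..T}. (X has_vector_derivative u (X t) t) (at t within {0..T}))"

text \<open>
  One-sided at \<open>0\<close>. If \<open>X\<close> is only meaningful on \<open>[0,T]\<close> with \<open>T > 0\<close>, its values beyond \<open>T\<close> do
  not matter, because \<open>\<eta>\<close> may always be decreased.
\<close>

definition analytic_at_0 :: "(real \<Rightarrow> 'b::real_normed_vector) \<Rightarrow> bool" where
  "analytic_at_0 X \<longleftrightarrow> (\<exists>\<eta>>0. \<exists>a. \<forall>t\<in>{0..<\<eta>}. (\<lambda>n. t ^ n *\<^sub>R a n) sums X t)"

end

theory Submission
  imports Defs
begin

text \<open>
  In one space dimension a simple wave solves the Euler equations as soon as its characteristic speed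
  \<open>w = u - c\<close> solves the Burgers equation. Fluid particles move faster than these characteristics, so
  a particle starting at the origin meets at time \<open>t > 0\<close> the values of the initial datum at a point
  \<open>\<xi>(t) > 0\<close>. Take the datum \<open>exp (- 1 / x)\<close> for \<open>x > 0\<close>, extended by \<open>0\<close>: it is increasing, so that no
  shock forms, and flat at \<open>0\<close>. The trajectory then deviates from a uniform motion by a function that is
  positive for \<open>t > 0\<close> but is \<open>O(t\<^sup>n)\<close> for every \<open>n\<close>, and so is not analytic at \<open>0\<close>.
\<close>

section \<open>Closure properties of \<open>C\<^sup>k\<close> functions\<close>

text \<open>The derivative of the composite in direction \<open>v\<close> is the derivative of
  \<open>f\<close> in the fixed direction \<open>L v\<close>, composed with the same affine map, so
  the induction closes.\<close>

lemma Ck_on_compose_affine: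
  fixes L :: "'a::euclidean_space \<Rightarrow> 'b::euclidean_space" and f :: "'b \<Rightarrow> 'c::real_normed_vector"
  assumes "bounded_linear L" "\<And>x. x \<in> S \<Longrightarrow> L x + b \<in> U" "Ck_on k f U"
  shows "Ck_on k (\<lambda>x. f (L x + b)) S"
  using assms(3)
proof (induction k arbitrary: f)
  case 0
  have "continuous_on S (\<lambda>x. L x + b)"
    using assms(1) by (intro continuous_intros linear_continuous_on)
  then show ?case
    using 0 assms(2) by (auto intro: continuous_on_compose2)
next
  case (Suc k)
  then obtain f' where f': "\<And>x. x \<in> U \<Longrightarrow> (f has_derivative f' x) (at x within U)"
    and Ck: "\<And>v. Ck_on k (\<lambda>x. f' x v) U"
    by auto
  have "((\<lambda>x. f (L x + b)) has_derivative (\<lambda>v. f' (L x + b) (L v))) (at x within S)"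
    if "x \<in> S" for x
  proof (rule has_derivative_in_compose[where f = "\<lambda>x. L x + b" and g = f])
    show "((\<lambda>x. L x + b) has_derivative L) (at x within S)"
      using assms(1) by (auto intro!: derivative_eq_intros bounded_linear_imp_has_derivative)
    show "(f has_derivative f' (L x + b)) (at (L x + b) within (\<lambda>x. L x + b) ` S)"
      using assms(2) that by (intro has_derivative_subset[OF f']) auto
  qed
  moreover have "Ck_on k (\<lambda>x. f' (L x + b) (L v)) S" for v
    using Suc.IH[OF Ck] .
  ultimately show ?case
    by (auto intro!: exI[of _ "\<lambda>x v. f' (L x + b) (L v)"])
qed

lemma Ck_on_linear:
  fixes f :: "'a::euclidean_space \<Rightarrow> 'b::real_normed_vector"
  assumes "bounded_linear L" "Ck_on k f S"
  shows "Ck_on k (\<lambda>x. L (f x)) S"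
  using assms(2)
proof (induction k arbitrary: f)
  case 0
  then show ?case
    by (auto intro: bounded_linear.continuous_on[OF assms(1)])
next
  case (Suc k)
  then obtain f' where "\<And>x. x \<in> S \<Longrightarrow> (f has_derivative f' x) (at x within S)"
    and "\<And>v. Ck_on k (\<lambda>x. f' x v) S"
    by auto
  then show ?case
    using Suc.IH
    by (auto intro!: exI[of _ "\<lambda>x v. L (f' x v)"] bounded_linear.has_derivative[OF assms(1)])
qed

lemma Ck_on_cong:
  fixes f g :: "'a::euclidean_space \<Rightarrow> 'b::real_normed_vector"
  assumes "\<And>x. x \<in> S \<Longrightarrow> f x = g x" "Ck_on k f S"
  shows "Ck_on k g S"
proof (cases k)
  case 0
  then show ?thesis
    using assms by (simp cong: continuous_on_cong)
next
  case (Suc j)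
  then obtain f' where "\<And>x. x \<in> S \<Longrightarrow> (f has_derivative f' x) (at x within S)"
    and "\<And>v. Ck_on j (\<lambda>x. f' x v) S"
    using assms(2) by auto
  moreover from this(1) have "(g has_derivative f' x) (at x within S)" if "x \<in> S" for x
    using that assms(1) by (intro has_derivative_transform[OF that, of g f]) auto
  ultimately show ?thesis
    using Suc by auto
qed

lemma Ck_on_const: "Ck_on k (\<lambda>x. c) S"
  by (induction k arbitrary: c) (auto intro!: exI[of _ "\<lambda>x v. 0"])

lemma Ck_on_bounded_linear:
  fixes L :: "'a::euclidean_space \<Rightarrow> 'b::real_normed_vector"
  assumes "bounded_linear L"
  shows "Ck_on k L S"
proof (cases k)
  case 0
  then show ?thesis
    using assms by (simp add: linear_continuous_on)
next
  case (Suc j)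
  then show ?thesis
    using assms by (auto intro!: exI[of _ "\<lambda>x. L"] Ck_on_const bounded_linear_imp_has_derivative)
qed

lemma Ck_on_Suc_imp: "Ck_on (Suc k) f S \<Longrightarrow> Ck_on k f S"
proof (induction k arbitrary: f)
  case 0
  then show ?case
    by (auto intro: has_derivative_continuous_on)
next
  case (Suc k)
  then obtain f' where "\<forall>x\<in>S. (f has_derivative f' x) (at x within S)"
    "\<And>v. Ck_on (Suc k) (\<lambda>x. f' x v) S"
    by (auto simp only: Ck_on.simps(2)[of "Suc k"])
  then show ?case
    using Suc.IH by auto
qed

lemma Ck_on_add:
  fixes f g :: "'a::euclidean_space \<Rightarrow> 'b::real_normed_vector"
  assumes "Ck_on k f S" "Ck_on k g S"
  shows "Ck_on k (\<lambda>x. f x + g x) S"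
  using assms
proof (induction k arbitrary: f g)
  case 0
  then show ?case
    by (auto intro: continuous_on_add)
next
  case (Suc k)
  from Suc.prems(1) obtain f' where "\<And>x. x \<in> S \<Longrightarrow> (f has_derivative f' x) (at x within S)"
    "\<And>v. Ck_on k (\<lambda>x. f' x v) S"
    by auto
  moreover from Suc.prems(2) obtain g' where "\<And>x. x \<in> S \<Longrightarrow> (g has_derivative g' x) (at x within S)"
    "\<And>v. Ck_on k (\<lambda>x. g' x v) S"
    by auto
  ultimately show ?case
    using Suc.IH by (auto intro!: exI[of _ "\<lambda>x v. f' x v + g' x v"] has_derivative_add)
qed

lemma Ck_on_mult:
  fixes f g :: "'a::euclidean_space \<Rightarrow> real"
  assumes "Ck_on k f S" "Ck_on k g S"
  shows "Ck_on k (\<lambda>x. f x * g x) S"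
  using assms
proof (induction k arbitrary: f g)
  case 0
  then show ?case
    by (auto intro: continuous_on_mult)
next
  case (Suc k)
  \<comment> \<open>The product rule keeps \<open>f\<close> and \<open>g\<close> undifferentiated,
    so both are also needed at the lower order \<open>k\<close>.\<close>
  note Ck = Suc.prems[THEN Ck_on_Suc_imp]
  from Suc.prems(1) obtain f' where f': "\<And>x. x \<in> S \<Longrightarrow> (f has_derivative f' x) (at x within S)"
    "\<And>v. Ck_on k (\<lambda>x. f' x v) S"
    by auto
  from Suc.prems(2) obtain g' where g': "\<And>x. x \<in> S \<Longrightarrow> (g has_derivative g' x) (at x within S)"
    "\<And>v. Ck_on k (\<lambda>x. g' x v) S"
    by auto
  have "Ck_on k (\<lambda>x. f x * g' x v + f' x v * g x) S" for v
    by (intro Ck_on_add Suc.IH Ck f' g')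
  then show ?case
    using has_derivative_mult[OF f'(1) g'(1)]
    by (auto intro!: exI[of _ "\<lambda>x v. f x * g' x v + f' x v * g x"])
qed

text \<open>The whole sequence of derivatives \<open>D\<close> is carried along and \<open>n\<close>
  stays general in the induction, because the chain rule turns \<open>D n\<close> into
  \<open>D (Suc n)\<close>.\<close>

lemma Ck_on_compose_real:
  fixes f :: "'a::euclidean_space \<Rightarrow> real" and D :: "nat \<Rightarrow> real \<Rightarrow> real"
  assumes "\<And>n y. y \<in> U \<Longrightarrow> (D n has_real_derivative D (Suc n) y) (at y)"
    and "\<And>x. x \<in> S \<Longrightarrow> f x \<in> U" and "Ck_on k f S"
  shows "Ck_on k (\<lambda>x. D n (f x)) S"
  using assms(3)
proof (induction k arbitrary: n)
  case 0
  have "continuous_on U (D n)"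
    using assms(1) by (meson DERIV_continuous_on has_field_derivative_at_within)
  then show ?case
    using 0 assms(2) by (auto intro: continuous_on_compose2)
next
  case (Suc k)
  note Ck = Suc.IH[OF Ck_on_Suc_imp[OF Suc.prems]]
  from Suc.prems obtain f' where f': "\<And>x. x \<in> S \<Longrightarrow> (f has_derivative f' x) (at x within S)"
    "\<And>v. Ck_on k (\<lambda>x. f' x v) S"
    by auto
  have "((\<lambda>x. D n (f x)) has_derivative (\<lambda>v. D (Suc n) (f x) * f' x v)) (at x within S)"
    if "x \<in> S" for x
  proof (rule has_derivative_compose[OF f'(1)[OF that]])
    show "(D n has_derivative (*) (D (Suc n) (f x))) (at (f x))"
      using assms(1,2) that by (auto simp: has_field_derivative_def)
  qed
  moreover have "Ck_on k (\<lambda>x. D (Suc n) (f x) * f' x v) S" for v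
    by (intro Ck_on_mult Ck f')
  ultimately show ?case
    by (auto intro!: exI[of _ "\<lambda>x v. D (Suc n) (f x) * f' x v"])
qed

lemma Ck_on_powr:
  fixes f :: "'a::euclidean_space \<Rightarrow> real"
  assumes "\<And>x. x \<in> S \<Longrightarrow> f x > 0" and "Ck_on k f S"
  shows "Ck_on k (\<lambda>x. f x powr r) S"
proof -
  \<comment> \<open>The \<open>n\<close>-th derivative of \<open>y powr r\<close>, with a falling
    factorial as coefficient.\<close>
  define D where "D n y = (\<Prod>i<n. r - real i) * y powr (r - real n)" for n y
  have "Ck_on k (\<lambda>x. D 0 (f x)) S"
  proof (rule Ck_on_compose_real[where U = "{0<..}" and D = D])
    show "(D n has_real_derivative D (Suc n) y) (at y)" if "y \<in> {0<..}" for n y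
      unfolding D_def using that
      by (auto intro!: derivative_eq_intros simp: algebra_simps)
  qed (use assms in auto)
  then show ?thesis
    by (simp add: D_def)
qed

section \<open>A flat function\<close>

text \<open>With \<open>y = 1 / x\<close>, so that \<open>dy/dx = - y^2\<close>, the derivative of
  \<open>p(y) exp(- y)\<close> in \<open>x\<close> is
  \<open>y^2 (p(y) - p'(y)) exp(- y)\<close>.\<close>

primrec flat_poly :: "nat \<Rightarrow> real poly" where
  "flat_poly 0 = 1"
| "flat_poly (Suc n) = [:0, 0, 1:] * (flat_poly n - pderiv (flat_poly n))"

text \<open>The \<open>n\<close>-th derivative of the function equal to \<open>exp (- 1 / x)\<close> for \<open>x > 0\<close> and to \<open>0\<close> elsewhere.\<close>

definition flat :: "nat \<Rightarrow> real \<Rightarrow> real" where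
  "flat n x = (if x > 0 then poly (flat_poly n) (1 / x) * exp (- (1 / x)) else 0)"

text \<open>Under \<open>y = 1 / x\<close> this says that the exponential dominates every polynomial
  at infinity.\<close>

lemma poly_times_exp_minus_tendsto_0:
  "((\<lambda>x. poly p (1 / x) * exp (- (1 / x))) \<longlongrightarrow> (0::real)) (at_right 0)"
proof -
  have "((\<lambda>y. \<Sum>i\<le>degree p. coeff p i * (y ^ i / exp y)) \<longlongrightarrow> (\<Sum>i\<le>degree p. coeff p i * 0)) at_top"
    by (intro tendsto_intros tendsto_power_div_exp_0)
  then have "((\<lambda>y. poly p y * exp (- y)) \<longlongrightarrow> 0) at_top"
    by (simp add: poly_altdef sum_distrib_right exp_minus divide_inverse mult.assoc)
  from filterlim_compose[OF this filterlim_inverse_at_top_right] show ?thesis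
    by (simp add: inverse_eq_divide)
qed

lemma DERIV_flat: "(flat n has_real_derivative flat (Suc n) x) (at x)"
proof -
  consider "x > 0" | "x < 0" | "x = 0"
    by linarith
  then show ?thesis
  proof cases
    case 1
    have "((\<lambda>x. poly (flat_poly n) (1 / x) * exp (- (1 / x))) has_real_derivative flat (Suc n) x) (at x)"
      using 1 by (auto intro!: derivative_eq_intros DERIV_chain2[OF poly_DERIV]
          simp: flat_def field_simps power2_eq_square)
    then show ?thesis
      by (rule has_field_derivative_transform_within_open[where S = "{0<..}"])
        (use 1 in \<open>auto simp: flat_def\<close>)
  next
    case 2
    have "((\<lambda>x. 0) has_real_derivative flat (Suc n) x) (at x)"
      using 2 by (auto simp: flat_def)
    then show ?thesis
      by (rule has_field_derivative_transform_within_open[where S = "{..<0}"])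
        (use 2 in \<open>auto simp: flat_def\<close>)
  next
    case 3
    have "((\<lambda>h. flat n h / h) \<longlongrightarrow> 0) (at_left 0)"
      by (rule tendsto_eventually) (auto simp: flat_def eventually_at_filter)
    moreover have "((\<lambda>h. flat n h / h) \<longlongrightarrow> 0) (at_right 0)"
      \<comment> \<open>Dividing by \<open>h\<close> multiplies the polynomial in
        \<open>1 / h\<close> by its variable.\<close>
      using poly_times_exp_minus_tendsto_0[of "[:0, 1:] * flat_poly n"]
      by (rule Lim_transform_eventually) (auto simp: flat_def eventually_at_filter)
    ultimately show ?thesis
      using 3 by (auto simp: has_field_derivative_iff filterlim_at_split flat_def)
  qed
qed

text \<open>The exponential series at \<open>1 / x\<close> is at least its single term of index
  \<open>n\<close>; take reciprocals.\<close>

lemma flat_bound: "flat 0 x \<le> fact n * x ^ n" if "x \<ge> 0"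
proof (cases "x = 0")
  case False
  then have x: "x > 0"
    using that by auto
  have "(1 / x) ^ n / fact n \<le> exp (1 / x)"
    using sum_le_suminf[OF summable_exp, of "{n}" "1 / x"] x
    by (auto simp: exp_def divide_inverse mult.commute)
  then show ?thesis
    using x by (simp add: flat_def exp_minus field_simps)
qed (auto simp: flat_def)

lemma flat_0_nonneg: "0 \<le> flat 0 x" and flat_0_less_1: "flat 0 x < 1"
  and flat_0_pos_iff: "0 < flat 0 x \<longleftrightarrow> 0 < x"
  by (auto simp: flat_def)

text \<open>The first derivative is \<open>exp (- 1 / x) / x^2\<close> for positive
  \<open>x\<close>, so \<open>flat_bound\<close> with \<open>n = 2\<close> bounds it by
  \<open>fact 2\<close>.\<close>

lemma flat_1_nonneg: "0 \<le> flat (Suc 0) x" and flat_1_le_2: "flat (Suc 0) x \<le> 2"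
  using flat_bound[of x 2] by (auto simp: flat_def field_simps power2_eq_square)

lemma flat_eq_0: "x \<le> 0 \<Longrightarrow> flat n x = 0"
  by (simp add: flat_def)

section \<open>The Burgers equation\<close>

lemma derivative_ge_imp_expanding:
  fixes f f' :: "real \<Rightarrow> real"
  assumes D: "\<And>x. (f has_real_derivative f' x) (at x)" and f': "\<And>x. \<delta> \<le> f' x" and "\<delta> > 0"
  shows "\<delta> * \<bar>x - y\<bar> \<le> \<bar>f x - f y\<bar>"
proof -
  have "\<delta> * (b - a) \<le> f b - f a" if "a < b" for a b
  proof -
    obtain z where "f b - f a = (b - a) * f' z"
      using MVT2[OF \<open>a < b\<close>, of f f'] D by metis
    then show ?thesis
      using that mult_left_mono[OF f'[of z], of "b - a"] by (simp add: mult.commute)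
  qed
  from this[of x y] this[of y x] show ?thesis
    by (cases x y rule: linorder_cases) auto
qed

text \<open>Expansion gives injectivity and, with the intermediate value theorem, surjectivity; the
  slope never vanishes, so the inverse is differentiable. It serves both for the characteristics and
  for the arrival time of a particle.\<close>

lemma increasing_inverse:
  fixes f f' :: "real \<Rightarrow> real"
  assumes D: "\<And>x. (f has_real_derivative f' x) (at x)" and f': "\<And>x. \<delta> \<le> f' x" and \<delta>: "\<delta> > 0"
  obtains g where "\<And>y. f (g y) = y" "\<And>x. g (f x) = x"
    "\<And>y. (g has_real_derivative inverse (f' (g y))) (at y)"
proof -
  note expand = derivative_ge_imp_expanding[OF assms]
  have cont: "isCont f x" for x
    using D DERIV_isCont by blast
  have "inj f"
  proof (rule injI)
    show "x = y" if "f x = f y" for x y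
      using expand[of x y] that \<delta> by (simp add: mult_le_0_iff)
  qed
  have mono: "f a \<le> f b" if "a \<le> b" for a b
    using DERIV_nonneg_imp_nondecreasing[OF that, of f] D f' \<delta> by (meson less_le_trans order.order_iff_strict)
  have "\<exists>x. f x = y" for y
  proof -
    \<comment> \<open>Over a distance \<open>r\<close> from \<open>0\<close> the function changes by
      at least the distance of \<open>y\<close> from \<open>f 0\<close>, so a preimage lies between
      \<open>- r\<close> and \<open>r\<close>.\<close>
    define r where "r = \<bar>y - f 0\<bar> / \<delta>"
    have r: "r \<ge> 0" "\<delta> * r = \<bar>y - f 0\<bar>"
      using \<delta> by (auto simp: r_def)
    have "f (- r) \<le> y" "y \<le> f r"
      using expand[of r 0] expand[of "- r" 0] mono[of 0 r] mono[of "- r" 0] r by auto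
    then show ?thesis
      using IVT[of f "- r" y r] cont r(1) by auto
  qed
  then have "surj f"
    by (metis surj_def)
  define g where "g = inv f"
  have fg: "f (g y) = y" and gf: "g (f x) = x" for x y
    using \<open>inj f\<close> \<open>surj f\<close> by (simp_all add: g_def surj_f_inv_f)
  have "isCont g y" for y
    using isCont_inverse_function[of 1 "g y" g f] cont by (simp add: fg gf)
  then have "(g has_real_derivative inverse (f' (g y))) (at y)" for y
    using D f'[of "g y"] \<delta> by (intro DERIV_inverse_function[where a = "y - 1" and b = "y + 1"]) (auto simp: fg)
  with fg gf show ?thesis
    using that by blast
qed

text \<open>Negative times are admitted so that the slab \<open>t \<ge> 0\<close> lies in an open set. As \<^term>\<open>flat 0\<close> has
  slope at most \<open>2\<close>, characteristics do not cross between \<open>- 1 / 4\<close> and \<open>0\<close>.\<close>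

abbreviation t_min :: real where
  "t_min \<equiv> - (1 / 4)"

text \<open>The foot at time \<open>0\<close> of the characteristic through \<open>(s, t)\<close> for the Burgers equation with
  initial datum \<^term>\<open>flat 0\<close>.\<close>

definition foot :: "real \<Rightarrow> real \<Rightarrow> real" where
  "foot s t = (THE \<xi>. \<xi> + t * flat 0 \<xi> = s)"

lemma DERIV_characteristic:
  "((\<lambda>\<xi>. \<xi> + t * flat 0 \<xi>) has_real_derivative 1 + t * flat (Suc 0) x) (at x)"
  by (auto intro!: derivative_eq_intros DERIV_flat)

lemma characteristic_derivative_ge: "1 / 2 \<le> 1 + t * flat (Suc 0) \<xi>" if "t > t_min"
proof -
  have "- (1 / 4) * flat (Suc 0) \<xi> \<le> t * flat (Suc 0) \<xi>"
    using that flat_1_nonneg[of \<xi>] by (intro mult_right_mono) auto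
  then show ?thesis
    using flat_1_le_2[of \<xi>] by linarith
qed

lemma characteristic_expanding:
  assumes "t > t_min"
  shows "\<bar>x - y\<bar> \<le> 2 * \<bar>(x + t * flat 0 x) - (y + t * flat 0 y)\<bar>"
  using derivative_ge_imp_expanding[OF DERIV_characteristic characteristic_derivative_ge[OF assms], of x y]
  by simp

lemma foot_characteristic: "foot (\<xi> + t * flat 0 \<xi>) t = \<xi>" if t: "t > t_min"
  unfolding foot_def
proof (rule the_equality)
  show "x = \<xi>" if "x + t * flat 0 x = \<xi> + t * flat 0 \<xi>" for x
    using characteristic_expanding[OF t, of x \<xi>] that by simp
qed simp

lemma characteristic_foot: "foot s t + t * flat 0 (foot s t) = s" if t: "t > t_min"
proof -
  \<comment> \<open>The inverse provides the existence that the definite description in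
    \<open>foot\<close> requires.\<close>
  obtain g where "g s + t * flat 0 (g s) = s"
    by (rule increasing_inverse[OF DERIV_characteristic characteristic_derivative_ge[OF t]]) auto
  then show ?thesis
    using foot_characteristic[OF t, of "g s"] by simp
qed

abbreviation burgers_domain :: "(real \<times> real) set" where
  "burgers_domain \<equiv> UNIV \<times> {t_min<..}"

text \<open>Both feet are compared at the common time \<open>t\<close>. Changing the time of the
  second characteristic costs \<open>e\<close>, at most the time difference; with the spatial
  difference this is at most twice the distance, and \<open>characteristic_expanding\<close> doubles
  it again.\<close>

lemma continuous_foot: "continuous_on burgers_domain (\<lambda>p. foot (fst p) (snd p))"
proof -
  have "dist (foot s t) (foot s' t') \<le> 4 * dist (s, t) (s', t')" if "t > t_min" "t' > t_min" for s t s' t'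
  proof -
    let ?x = "foot s t" and ?y = "foot s' t'"
    define e where "e = (t' - t) * flat 0 ?y"
    have eq: "(?x + t * flat 0 ?x) - (?y + t * flat 0 ?y) = (s - s') + e"
      using characteristic_foot[of t s] characteristic_foot[of t' s'] that by (simp add: e_def algebra_simps)
    have e: "\<bar>e\<bar> \<le> \<bar>t' - t\<bar> * 1"
      unfolding abs_mult e_def using flat_0_nonneg[of ?y] flat_0_less_1[of ?y] by (intro mult_left_mono) auto
    let ?d = "dist (s, t) (s', t')"
    have "\<bar>s - s'\<bar> \<le> ?d" "\<bar>t' - t\<bar> * 1 \<le> ?d"
      using dist_fst_le[of "(s, t)" "(s', t')"] dist_snd_le[of "(s, t)" "(s', t')"]
      by (auto simp: dist_real_def abs_minus_commute)
    then have "\<bar>(s - s') + e\<bar> \<le> ?d + ?d"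
      by (intro order_trans[OF abs_triangle_ineq] add_mono order_trans[OF e])
    then show ?thesis
      using characteristic_expanding[OF that(1), of ?x ?y] unfolding eq dist_real_def[of ?x] by argo
  qed
  then have "4-lipschitz_on burgers_domain (\<lambda>p. foot (fst p) (snd p))"
    by (intro lipschitz_onI) auto
  then show ?thesis
    by (rule lipschitz_on_continuous_on)
qed

definition jac :: "real \<Rightarrow> real \<Rightarrow> real" where
  "jac s t = 1 + t * flat (Suc 0) (foot s t)"

lemma jac_pos: "t > t_min \<Longrightarrow> jac s t > 0"
  using characteristic_derivative_ge[of t "foot s t"] by (simp add: jac_def)

text \<open>Keeping the time as a second component makes \<open>foot\<close> the first component of
  the inverse \<open>G\<close> of a map \<open>F\<close> of the plane. The derivative of
  \<open>F\<close> is triangular and is inverted explicitly.\<close>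

lemma foot_has_derivative:
  assumes "t > t_min"
  shows "((\<lambda>p. foot (fst p) (snd p)) has_derivative
    (\<lambda>v. (fst v - snd v * flat 0 (foot s t)) / jac s t)) (at (s, t))"
proof -
  define F where "F p = (fst p + snd p * flat 0 (fst p), snd p)" for p :: "real \<times> real"
  define G where "G p = (foot (fst p) (snd p), snd p)" for p :: "real \<times> real"
  let ?\<xi> = "foot s t"
  have flat: "((\<lambda>p. flat 0 (fst p)) has_derivative (\<lambda>v. flat (Suc 0) ?\<xi> * fst v)) (at (?\<xi>, t))"
    using has_derivative_compose[OF has_derivative_fst[OF has_derivative_ident],
        of "flat 0" "(*) (flat (Suc 0) ?\<xi>)" "(?\<xi>, t)" UNIV] DERIV_flat[of 0 ?\<xi>]
    by (simp add: has_field_derivative_def)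
  have "(G has_derivative (\<lambda>v. ((fst v - snd v * flat 0 ?\<xi>) / jac s t, snd v))) (at (s, t))"
  proof (rule has_derivative_inverse_basic[where f = F and T = burgers_domain])
    show "(F has_derivative (\<lambda>v. (fst v + (t * (flat (Suc 0) ?\<xi> * fst v) + snd v * flat 0 ?\<xi>), snd v)))
      (at (G (s, t)))"
      unfolding F_def G_def by (auto intro!: derivative_eq_intros flat)
    show "bounded_linear (\<lambda>v. ((fst v - snd v * flat 0 ?\<xi>) / jac s t, snd v))"
      by (intro bounded_linear_Pair bounded_linear_divide[THEN bounded_linear_compose] bounded_linear_sub
          bounded_linear_fst bounded_linear_snd bounded_linear_mult_left[THEN bounded_linear_compose])
    show "(\<lambda>v. ((fst v - snd v * flat 0 ?\<xi>) / jac s t, snd v)) \<circ>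
        (\<lambda>v. (fst v + (t * (flat (Suc 0) ?\<xi> * fst v) + snd v * flat 0 ?\<xi>), snd v)) = id"
      using jac_pos[OF assms, of s] by (auto simp: fun_eq_iff jac_def field_simps)
    show "open burgers_domain"
      by (intro open_Times) auto
    moreover show "(s, t) \<in> burgers_domain"
      using assms by auto
    ultimately have "isCont (\<lambda>p. foot (fst p) (snd p)) (s, t)"
      using continuous_foot continuous_on_eq_continuous_at by blast
    then show "continuous (at (s, t)) G"
      unfolding G_def by (intro continuous_intros) auto
    show "F (G z) = z" if "z \<in> burgers_domain" for z
      using that characteristic_foot[of "snd z" "fst z"] by (auto simp: F_def G_def)
  qed
  from has_derivative_fst[OF this] show ?thesis
    by (simp add: G_def)
qed

text \<open>Bootstrapping: the derivative of the foot is expressed through \<open>flat\<close> at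
  the foot itself, so regularity of order \<open>k\<close> of the foot passes to its
  derivative.\<close>

lemma Ck_on_foot: "Ck_on k (\<lambda>p. foot (fst p) (snd p)) burgers_domain"
proof (induction k)
  case 0
  show ?case
    by (simp add: continuous_foot)
next
  case (Suc k)
  let ?\<xi> = "\<lambda>p. foot (fst p) (snd p)"
  have flat: "Ck_on k (\<lambda>p. flat n (?\<xi> p)) burgers_domain" for n
    by (rule Ck_on_compose_real[where D = flat and U = UNIV]) (auto intro: DERIV_flat Suc.IH)
  \<comment> \<open>The reciprocal is written as a power so that \<open>Ck_on_powr\<close> covers
    it.\<close>
  have "Ck_on k (\<lambda>p. jac (fst p) (snd p) powr (- 1)) burgers_domain"
    unfolding jac_def
    by (intro Ck_on_powr Ck_on_add Ck_on_const Ck_on_mult Ck_on_bounded_linear[OF bounded_linear_snd] flat)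
      (auto intro: jac_pos[unfolded jac_def])
  then have *: "Ck_on k (\<lambda>p. (fst v + (- snd v) * flat 0 (?\<xi> p)) * jac (fst p) (snd p) powr (- 1)) burgers_domain" for v
    by (intro Ck_on_mult Ck_on_add Ck_on_const flat)
  have "Ck_on k (\<lambda>p. (fst v - snd v * flat 0 (?\<xi> p)) / jac (fst p) (snd p)) burgers_domain" for v
  proof (rule Ck_on_cong[OF _ *[of v]])
    fix p :: "real \<times> real"
    assume "p \<in> burgers_domain"
    then have "jac (fst p) (snd p) > 0"
      by (auto intro: jac_pos)
    then show "(fst v + - snd v * flat 0 (?\<xi> p)) * jac (fst p) (snd p) powr - 1 =
      (fst v - snd v * flat 0 (?\<xi> p)) / jac (fst p) (snd p)"
      by (simp add: powr_minus divide_inverse)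
  qed
  moreover have "(?\<xi> has_derivative (\<lambda>v. (fst v - snd v * flat 0 (?\<xi> p)) / jac (fst p) (snd p)))
      (at p within burgers_domain)" if "p \<in> burgers_domain" for p
    using foot_has_derivative[of "snd p" "fst p"] that
    by (auto simp del: split_paired_All intro: has_derivative_at_withinI)
  ultimately show ?case
    unfolding Ck_on.simps
    by (intro exI[of _ "\<lambda>p v. (fst v - snd v * flat 0 (?\<xi> p)) / jac (fst p) (snd p)"] conjI ballI allI)
qed

section \<open>The Burgers solution, transported unchanged along characteristics\<close>

definition burgers :: "real \<Rightarrow> real \<Rightarrow> real" where
  "burgers s t = flat 0 (foot s t)"

definition burgers_x :: "real \<Rightarrow> real \<Rightarrow> real" where
  "burgers_x s t = flat (Suc 0) (foot s t) / jac s t"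

lemma Ck_on_burgers: "Ck_on k (\<lambda>p. burgers (fst p) (snd p)) burgers_domain"
  unfolding burgers_def
  by (rule Ck_on_compose_real[where D = flat and U = UNIV]) (auto intro: DERIV_flat Ck_on_foot)

lemma burgers_less_1: "burgers s t < 1"
  by (simp add: burgers_def flat_0_less_1)

text \<open>The value \<open>2\<close> is the vacuum state of the simple wave below, where its sound
  speed vanishes.\<close>

lemma burgers_less_2: "burgers s t < 2"
  using burgers_less_1[of s t] by linarith

lemma burgers_has_derivative:
  assumes "t > t_min"
  shows "((\<lambda>p. burgers (fst p) (snd p)) has_derivative
    (\<lambda>v. burgers_x s t * (fst v - snd v * burgers s t))) (at (s, t))"
  using has_derivative_compose[OF foot_has_derivative[OF assms],
      of "flat 0" "(*) (flat (Suc 0) (foot s t))" s] DERIV_flat[of 0 "foot s t"]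
  by (simp add: has_field_derivative_def burgers_def burgers_x_def)

text \<open>Together with \<open>burgers_DERIV_x\<close> this is the Burgers equation
  \<open>w_t + w w_x = 0\<close>.\<close>

lemma burgers_DERIV_t:
  assumes "t > t_min"
  shows "((\<lambda>t. burgers s t) has_real_derivative - burgers s t * burgers_x s t) (at t)"
proof -
  have "((\<lambda>t. (s, t)) has_derivative (\<lambda>h. (0, h))) (at t)"
    by (auto intro!: derivative_eq_intros)
  from has_derivative_compose[OF this burgers_has_derivative[OF assms]]
  have "(burgers s has_derivative (\<lambda>h. burgers_x s t * - (h * burgers s t))) (at t)"
    by simp
  then show ?thesis
    unfolding has_field_derivative_def by (rule has_derivative_eq_rhs) (auto simp: fun_eq_iff)
qed

lemma burgers_DERIV_x:
  assumes "t > t_min"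
  shows "((\<lambda>s. burgers s t) has_real_derivative burgers_x s t) (at s)"
proof -
  have "((\<lambda>s. (s, t)) has_derivative (\<lambda>h. (h, 0))) (at s)"
    by (auto intro!: derivative_eq_intros)
  from has_derivative_compose[OF this burgers_has_derivative[OF assms]]
  have "((\<lambda>s. burgers s t) has_derivative (\<lambda>h. burgers_x s t * h)) (at s)"
    by simp
  then show ?thesis
    unfolding has_field_derivative_def by (rule has_derivative_eq_rhs) (auto simp: fun_eq_iff)
qed

section \<open>Simple waves and their trajectories\<close>

text \<open>Once the coefficients below \<open>n\<close> vanish, \<open>f t / t ^ n\<close> is a
  power series with constant term \<open>a n\<close>, while flatness of order \<open>Suc n\<close>
  makes it \<open>O(t)\<close>.\<close>

lemma flat_power_series_eq_0:
  fixes a :: "nat \<Rightarrow> real"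
  assumes "\<eta> > 0" and sums: "\<And>t. 0 < t \<Longrightarrow> t < \<eta> \<Longrightarrow> (\<lambda>n. a n * t ^ n) sums f t"
    and flat: "\<And>n. \<exists>C. \<forall>t. 0 < t \<and> t < \<eta> \<longrightarrow> \<bar>f t\<bar> \<le> C * t ^ n"
  shows "a n = 0"
proof (induction n rule: less_induct)
  case (less n)
  define G where "G t = (\<Sum>k. a (k + n) * t ^ k)" for t :: real
  obtain C where C: "\<And>t. 0 < t \<Longrightarrow> t < \<eta> \<Longrightarrow> \<bar>f t\<bar> \<le> C * t ^ Suc n"
    using flat[of "Suc n"] by blast
  have shift: "(\<lambda>k. a (k + n) * t ^ k) sums (f t / t ^ n)" if "0 < t" "t < \<eta>" for t
  proof -
    have "(\<lambda>k. a (k + n) * t ^ (k + n)) sums f t"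
      using sums[OF that] less.IH by (simp add: sums_iff_shift[of "\<lambda>k. a k * t ^ k" n])
    from sums_divide[OF this, of "t ^ n"] show ?thesis
      using that by (simp add: power_add)
  qed
  have "(G \<longlongrightarrow> a (0 + n)) (at 0)"
  proof (rule powser_limit_0[of "\<eta> / 2"])
    show "(\<lambda>k. a (k + n) * x ^ k) sums G x" if "norm x < \<eta> / 2" for x
      \<comment> \<open>Convergence at the positive point \<open>\<eta> / 2\<close> yields
        convergence on both sides of \<open>0\<close>, as \<open>powser_limit_0\<close>
        demands.\<close>
      using powser_inside[OF sums_summable[OF shift[of "\<eta> / 2"]], of x] that \<open>\<eta> > 0\<close>
      by (simp add: G_def summable_sums)
  qed (use \<open>\<eta> > 0\<close> in auto)
  then have "(G \<longlongrightarrow> a n) (at_right 0)"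
    by (simp add: filterlim_at_split)
  moreover have "(G \<longlongrightarrow> 0) (at_right 0)"
  proof (rule Lim_null_comparison)
    have "norm (G t) \<le> C * t" if "0 < t" "t < \<eta>" for t
    proof -
      have "f t = G t * t ^ n"
        using sums_unique[OF shift[OF that]] that by (simp add: G_def field_simps)
      then have "\<bar>G t\<bar> * t ^ n \<le> (C * t) * t ^ n"
        using C[OF that] that by (simp add: abs_mult mult.assoc)
      then show ?thesis
        using that by simp
    qed
    then show "eventually (\<lambda>t. norm (G t) \<le> C * t) (at_right 0)"
      using \<open>\<eta> > 0\<close> by (auto simp: eventually_at_right_field)
    show "((\<lambda>t. C * t) \<longlongrightarrow> 0) (at_right 0)"
      by (auto intro!: tendsto_eq_intros)
  qed
  ultimately show "a n = 0"
    using tendsto_unique trivial_limit_at_right_real by blast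
qed

lemma continuous_antiderivative:
  fixes f :: "real \<Rightarrow> real"
  assumes "continuous_on UNIV f"
  obtains F where "F 0 = 0" "\<And>x. (F has_real_derivative f x) (at x)"
proof -
  obtain F where F: "\<And>x. (F has_vector_derivative f x) (at x)"
    using einterval_antiderivative[of "-\<infinity>" "\<infinity>" f] assms by (auto simp: continuous_on_eq_continuous_at)
  show ?thesis
  proof (rule that[of "\<lambda>x. F x - F 0"])
    show "((\<lambda>x. F x - F 0) has_real_derivative f x) (at x)" for x
      using F[of x] by (auto intro!: derivative_eq_intros simp: has_real_derivative_iff_has_vector_derivative)
  qed simp
qed

lemma has_vector_derivative_scaleR_const:
  "(f has_real_derivative f') (at x within S) \<Longrightarrow>
    ((\<lambda>t. f t *\<^sub>R e) has_vector_derivative f' *\<^sub>R e) (at x within S)"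
  using has_vector_derivative_scaleR[of f f' x S "\<lambda>_. e" 0] by simp

lemma pderiv_x_compose_nth:
  assumes "(g has_vector_derivative g') (at (x $ i))"
  shows "pderiv_x j (\<lambda>y. g (y $ i)) x = (if j = i then g' else 0)"
proof -
  have "((\<lambda>y. g (y $ i)) has_derivative (\<lambda>v. (v $ i) *\<^sub>R g')) (at x)"
    using has_derivative_compose[OF bounded_linear_imp_has_derivative[OF bounded_linear_vec_nth]]
      assms[unfolded has_vector_derivative_def] by blast
  from frechet_derivative_at[OF this, symmetric] show ?thesis
    by (auto simp: pderiv_x_def axis_def)
qed

text \<open>A linear map sends the slab into the open set \<open>burgers_domain\<close>, so the
  one-sided derivatives on its faces are inherited from two-sided ones.\<close>

lemma smooth_on_slab:
  fixes f :: "real \<times> real \<Rightarrow> 'b::real_normed_vector"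
  assumes "\<And>k. Ck_on k f burgers_domain"
  shows "smooth_on (\<lambda>(x :: real ^ 2, t). f (x $ 1, t)) (UNIV \<times> {0..T})"
  unfolding smooth_on_def
proof
  fix k
  have "bounded_linear (\<lambda>p :: (real ^ 2) \<times> real. (fst p $ 1, snd p))"
    by (intro bounded_linear_Pair bounded_linear_snd
        bounded_linear_compose[OF bounded_linear_vec_nth bounded_linear_fst])
  from Ck_on_compose_affine[OF this, of "UNIV \<times> {0..T}" 0, OF _ assms[of k]]
  show "Ck_on k (\<lambda>(x :: real ^ 2, t). f (x $ 1, t)) (UNIV \<times> {0..T})"
    by (force simp: case_prod_unfold zero_prod_def)
qed

lemma smooth_on_initial:
  fixes f :: "real \<times> real \<Rightarrow> 'b::real_normed_vector"
  assumes "\<And>k. Ck_on k f burgers_domain"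
  shows "smooth_on (\<lambda>x :: real ^ 2. f (x $ 1, 0)) UNIV"
  unfolding smooth_on_def
proof
  fix k
  have "bounded_linear (\<lambda>x :: real ^ 2. (x $ 1, 0 :: real))"
    by (intro bounded_linear_Pair bounded_linear_vec_nth bounded_linear_zero)
  from Ck_on_compose_affine[OF this, of UNIV 0, OF _ assms[of k]]
  show "Ck_on k (\<lambda>x :: real ^ 2. f (x $ 1, 0)) UNIV"
    by (force simp: zero_prod_def)
qed

context
  fixes A \<gamma> :: real
  assumes A_pos: "A > 0" and gamma_gt_1: "\<gamma> > 1"
begin

text \<open>A simple wave is a solution all of whose states lie on a curve \<open>u + 2 c / (\<gamma> - 1) = const\<close> with
  sound speed \<open>c\<close>. The curve is parametrised by the characteristic speed \<open>w = u - c\<close>, the constant is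
  \<open>2\<close>, and then the Euler equations reduce to the Burgers equation for \<open>w\<close>.\<close>

definition vel_slope :: real where
  "vel_slope = 2 / (\<gamma> + 1)"

text \<open>This and \<open>sound_speed\<close> solve \<open>u - c = w\<close> and
  \<open>u + 2 c / (\<gamma> - 1) = 2\<close> for \<open>u\<close> and \<open>c\<close>.\<close>

definition velocity :: "real \<Rightarrow> real" where
  "velocity w = 2 * (1 - vel_slope) + vel_slope * w"

definition sound_speed :: "real \<Rightarrow> real" where
  "sound_speed w = (1 - vel_slope) * (2 - w)"

text \<open>The relation \<open>c^2 = p'(\<rho>)\<close> between sound speed and density, solved for
  \<open>\<rho>\<close>.\<close>

definition density :: "real \<Rightarrow> real" where
  "density w = (A * \<gamma>) powr (- 1 / (\<gamma> - 1)) * sound_speed w powr (2 / (\<gamma> - 1))"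

lemma vel_slope_pos: "vel_slope > 0" and vel_slope_less_1: "vel_slope < 1"
  using gamma_gt_1 by (auto simp: vel_slope_def)

lemma velocity_minus_sound_speed: "velocity w - sound_speed w = w"
  by (simp add: velocity_def sound_speed_def algebra_simps)

lemma sound_speed_pos: "w < 2 \<Longrightarrow> sound_speed w > 0"
  using vel_slope_less_1 by (simp add: sound_speed_def)

lemma density_pos: "w < 2 \<Longrightarrow> density w > 0"
  using A_pos gamma_gt_1 sound_speed_pos[of w] by (auto simp: density_def intro!: mult_pos_pos)

lemma DERIV_density:
  assumes "w < 2"
  shows "(density has_real_derivative - vel_slope * density w / sound_speed w) (at w)"
proof -
  note c = sound_speed_pos[OF assms]
  define B where "B = (A * \<gamma>) powr (- 1 / (\<gamma> - 1))"
  define k where "k = 2 / (\<gamma> - 1)"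
  have "1 - vel_slope = (\<gamma> - 1) / (\<gamma> + 1)"
    using gamma_gt_1 by (simp add: vel_slope_def field_simps)
  \<comment> \<open>Constancy of \<open>u + k c\<close> in differential form:
    \<open>u' = - k c'\<close>, primes denoting derivatives in \<open>w\<close>. It turns
    \<open>\<rho>' / \<rho> = k c' / c\<close> into \<open>- u' / c\<close>.\<close>
  then have k: "k * (1 - vel_slope) = vel_slope"
    using gamma_gt_1 by (simp add: vel_slope_def k_def del: right_diff_distrib_numeral left_diff_distrib_numeral)
  have "(sound_speed has_real_derivative - (1 - vel_slope)) (at w)"
    unfolding sound_speed_def by (auto intro!: derivative_eq_intros)
  then have "(density has_real_derivative B * (k * sound_speed w powr (k - 1) * - (1 - vel_slope))) (at w)"
    unfolding density_def B_def[symmetric] k_def[symmetric] using c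
    by (intro DERIV_cmult) (auto intro!: derivative_eq_intros)
  also have "B * (k * sound_speed w powr (k - 1) * - (1 - vel_slope)) =
      - (k * (1 - vel_slope)) * (B * sound_speed w powr k) / sound_speed w"
    using c by (simp add: powr_diff field_simps)
  finally have "(density has_real_derivative - vel_slope * (B * sound_speed w powr k) / sound_speed w) (at w)"
    unfolding k .
  moreover have "density w = B * sound_speed w powr k"
    by (simp add: density_def B_def k_def)
  ultimately show ?thesis
    by (simp only:)
qed

lemma density_powr:
  assumes "w < 2"
  shows "A * \<gamma> * density w powr (\<gamma> - 1) = (sound_speed w)\<^sup>2"
proof -
  define b where "b = A * \<gamma>"
  have "b > 0"
    using A_pos gamma_gt_1 by (simp add: b_def)
  have "density w powr (\<gamma> - 1) = b powr (- 1) * sound_speed w powr 2"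
    using gamma_gt_1 unfolding density_def b_def[symmetric]
    by (simp add: powr_mult powr_powr del: right_diff_distrib_numeral left_diff_distrib_numeral)
  then show ?thesis
    using \<open>b > 0\<close> sound_speed_pos[OF assms] by (simp add: b_def[symmetric] powr_minus)
qed

text \<open>By the chain rule and \<open>density_powr\<close>, the derivative is
  \<open>c^2 \<rho>'\<close>.\<close>

lemma DERIV_pressure:
  assumes "w < 2"
  shows "((\<lambda>w. A * density w powr \<gamma>) has_real_derivative - vel_slope * density w * sound_speed w) (at w)"
proof -
  have "((\<lambda>w. A * density w powr \<gamma>) has_real_derivative
      A * (\<gamma> * density w powr (\<gamma> - 1) * (- vel_slope * density w / sound_speed w))) (at w)"
    using DERIV_density[OF assms] density_pos[OF assms]
    by (intro DERIV_cmult) (auto intro!: derivative_eq_intros)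
  moreover have "A * (\<gamma> * density w powr (\<gamma> - 1) * (- vel_slope * density w / sound_speed w))
      = (sound_speed w)\<^sup>2 * (- vel_slope * density w / sound_speed w)"
    by (simp flip: density_powr[OF assms])
  then have "A * (\<gamma> * density w powr (\<gamma> - 1) * (- vel_slope * density w / sound_speed w))
      = - vel_slope * density w * sound_speed w"
    using sound_speed_pos[OF assms] by (simp add: power2_eq_square)
  ultimately show ?thesis
    by simp
qed

section \<open>The plane wave as a solution of the Euler equations\<close>

definition wave_density :: "real ^ 2 \<Rightarrow> real \<Rightarrow> real" where
  "wave_density x t = density (burgers (x $ 1) t)"

definition wave_velocity :: "real ^ 2 \<Rightarrow> real \<Rightarrow> real ^ 2" where
  "wave_velocity x t = velocity (burgers (x $ 1) t) *\<^sub>R axis 1 1"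

lemma Ck_on_density: "Ck_on k (\<lambda>p. density (burgers (fst p) (snd p))) burgers_domain"
proof -
  have "Ck_on k (\<lambda>p. sound_speed (burgers (fst p) (snd p)) powr r) burgers_domain" for r
  proof (rule Ck_on_powr)
    have "Ck_on k (\<lambda>p. (1 - vel_slope) * (2 + (- 1) * burgers (fst p) (snd p))) burgers_domain"
      by (intro Ck_on_mult Ck_on_add Ck_on_const Ck_on_burgers)
    then show "Ck_on k (\<lambda>p. sound_speed (burgers (fst p) (snd p))) burgers_domain"
      by (simp add: sound_speed_def)
  qed (simp add: sound_speed_pos burgers_less_2)
  then show ?thesis
    unfolding density_def by (intro Ck_on_mult Ck_on_const)
qed

lemma Ck_on_velocity:
  "Ck_on k (\<lambda>p. velocity (burgers (fst p) (snd p)) *\<^sub>R (axis 1 1 :: real ^ 2)) burgers_domain"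
  unfolding velocity_def
  by (intro Ck_on_linear[OF bounded_linear_scaleR_left] Ck_on_add Ck_on_mult Ck_on_const Ck_on_burgers)

text \<open>As \<open>\<rho>' = - u' \<rho> / c\<close> and \<open>p' = - u' \<rho> c\<close>, both
  equations become multiples of \<open>w_t + (u - c) w_x\<close>, which is zero by the Burgers
  equation since \<open>u - c = w\<close>.\<close>

lemma smooth_euler_solution_wave:
  assumes "T > 0"
  shows "smooth_euler_solution (\<lambda>r. A * r powr \<gamma>) T wave_density wave_velocity"
  unfolding smooth_euler_solution_def
proof (intro conjI allI ballI)
  show "smooth_on (\<lambda>(x, t). wave_density x t) (UNIV \<times> {0..T})"
    using smooth_on_slab[OF Ck_on_density] by (simp add: wave_density_def)
  show "smooth_on (\<lambda>(x, t). wave_velocity x t) (UNIV \<times> {0..T})"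
    using smooth_on_slab[OF Ck_on_velocity] by (simp add: wave_velocity_def)
next
  fix x :: "real ^ 2" and t :: real
  assume t: "t \<in> {0..T}"
  then have t': "t > t_min"
    by simp
  let ?w = "burgers (x $ 1) t" and ?wx = "burgers_x (x $ 1) t" and ?e = "axis 1 1 :: real ^ 2"
  define c where "c = sound_speed ?w"
  define \<rho> where "\<rho> = density ?w"
  define u where "u = velocity ?w"
  have c: "c > 0" and \<rho>: "\<rho> > 0" and u: "u - c = ?w"
    using sound_speed_pos density_pos burgers_less_2 velocity_minus_sound_speed
    by (auto simp: c_def \<rho>_def u_def)
  show "wave_density x t > 0"
    using \<rho> by (simp add: wave_density_def \<rho>_def)
  note dens = DERIV_density[OF burgers_less_2[of "x $ 1" t], folded \<rho>_def c_def]
  have vel: "(velocity has_real_derivative vel_slope) (at ?w)"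
    unfolding velocity_def by (auto intro!: derivative_eq_intros)
  note w_x = burgers_DERIV_x[OF t', of "x $ 1"]
  note w_t = burgers_DERIV_t[OF t', of "x $ 1"]
  have rho_x: "((\<lambda>s. density (burgers s t)) has_real_derivative - vel_slope * \<rho> / c * ?wx) (at (x $ 1))"
    by (rule DERIV_chain2[OF dens w_x])
  have u_x: "((\<lambda>s. velocity (burgers s t)) has_real_derivative vel_slope * ?wx) (at (x $ 1))"
    by (rule DERIV_chain2[OF vel w_x])
  have p_x: "((\<lambda>s. A * density (burgers s t) powr \<gamma>) has_real_derivative - vel_slope * \<rho> * c * ?wx) (at (x $ 1))"
    unfolding \<rho>_def c_def by (rule DERIV_chain2[OF DERIV_pressure[OF burgers_less_2] w_x])
  \<comment> \<open>The wave is differentiable in time across \<open>0\<close>, so its derivative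
    within the interval is the two-sided one; \<open>T > 0\<close> makes it unique.\<close>
  have rho_t: "pderiv_t T (wave_density x) t = - vel_slope * \<rho> / c * (- ?w * ?wx)"
    unfolding pderiv_t_def wave_density_def
    using DERIV_chain2[OF dens w_t] assms t
    by (intro vector_derivative_within_closed_interval)
      (auto simp: has_real_derivative_iff_has_vector_derivative intro: has_vector_derivative_at_within)
  have u_t: "pderiv_t T (wave_velocity x) t = (vel_slope * (- ?w * ?wx)) *\<^sub>R ?e"
    unfolding pderiv_t_def wave_velocity_def
    using DERIV_chain2[OF vel w_t] assms t
    by (intro vector_derivative_within_closed_interval has_vector_derivative_scaleR_const)
      (auto intro: has_field_derivative_at_within)
  have rho_u: "pderiv_x j (\<lambda>y. wave_density y t *\<^sub>R wave_velocity y t) x =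
      (if j = 1 then (- vel_slope * \<rho> / c * ?wx * u + \<rho> * (vel_slope * ?wx)) *\<^sub>R ?e else 0)" for j
    unfolding wave_density_def wave_velocity_def scaleR_scaleR
  proof (rule pderiv_x_compose_nth)
    show "((\<lambda>s. (density (burgers s t) * velocity (burgers s t)) *\<^sub>R ?e) has_vector_derivative
        (- vel_slope * \<rho> / c * ?wx * u + \<rho> * (vel_slope * ?wx)) *\<^sub>R ?e) (at (x $ 1))"
      using DERIV_mult[OF rho_x u_x]
      by (intro has_vector_derivative_scaleR_const)
        (auto simp: \<rho>_def u_def mult_ac add.commute)
  qed
  have u_grad: "pderiv_x j (\<lambda>y. wave_velocity y t) x = (if j = 1 then (vel_slope * ?wx) *\<^sub>R ?e else 0)" for j
    unfolding wave_velocity_def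
    using u_x by (intro pderiv_x_compose_nth) (auto intro!: has_vector_derivative_scaleR_const)
  have p_grad: "pderiv_x j (\<lambda>y. A * wave_density y t powr \<gamma>) x = (if j = 1 then - vel_slope * \<rho> * c * ?wx else 0)" for j
    unfolding wave_density_def
    using p_x by (intro pderiv_x_compose_nth) (simp add: has_real_derivative_iff_has_vector_derivative)
  have "divergence (\<lambda>y. wave_density y t *\<^sub>R wave_velocity y t) x = - vel_slope * \<rho> / c * ?wx * u + \<rho> * (vel_slope * ?wx)"
    by (simp add: divergence_def rho_u sum_2 axis_def)
  then show "pderiv_t T (wave_density x) t + divergence (\<lambda>y. wave_density y t *\<^sub>R wave_velocity y t) x = 0"
    unfolding rho_t u[symmetric] using c by (simp add: field_simps)
  have u_comp: "wave_velocity x t $ j = (if j = 1 then u else 0)" for j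
    by (simp add: wave_velocity_def u_def axis_def)
  have "advect (wave_velocity x t) (\<lambda>y. wave_velocity y t) x = (u * (vel_slope * ?wx)) *\<^sub>R ?e"
    by (simp add: advect_def u_grad sum_2 u_comp)
  moreover have "gradient (\<lambda>y. A * wave_density y t powr \<gamma>) x = (- vel_slope * \<rho> * c * ?wx) *\<^sub>R ?e"
    by (simp add: gradient_def p_grad vec_eq_iff axis_def)
  moreover have "wave_density x t = \<rho>"
    by (simp add: wave_density_def \<rho>_def)
  ultimately show "pderiv_t T (wave_velocity x) t + advect (wave_velocity x t) (\<lambda>y. wave_velocity y t) x +
      (1 / wave_density x t) *\<^sub>R gradient (\<lambda>y. A * wave_density y t powr \<gamma>) x = 0"
    unfolding u_t u[symmetric] using \<rho> by (simp add: algebra_simps flip: scaleR_add_left)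
qed

text \<open>Along a trajectory the foot \<open>\<xi>\<close> of the characteristic satisfies
  \<open>(1 + t flat' \<xi>) d\<xi>/dt = c\<close>, which is linear for \<open>t\<close> as a function of \<open>\<xi>\<close>; an integrating factor
  solves it.\<close>

lemma arrival_time:
  obtains \<tau> where "\<tau> 0 = 0" "\<And>\<xi>. \<xi> \<le> 0 \<Longrightarrow> \<tau> \<xi> \<le> 0"
    "\<And>\<xi>. (\<tau> has_real_derivative (1 + \<tau> \<xi> * flat (Suc 0) \<xi>) / sound_speed (flat 0 \<xi>)) (at \<xi>)"
    "\<And>\<xi>. 1 / 2 \<le> (1 + \<tau> \<xi> * flat (Suc 0) \<xi>) / sound_speed (flat 0 \<xi>)"
proof -
  define a where "a = 1 / (1 - vel_slope)"
  define q where "q \<xi> = 2 - flat 0 \<xi>" for \<xi>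
  have q: "q \<xi> > 0" for \<xi>
    using flat_0_less_1[of \<xi>] by (simp add: q_def)
  have a: "a > 0" and c: "sound_speed (flat 0 \<xi>) = q \<xi> / a" for \<xi>
    using vel_slope_less_1 by (auto simp: a_def sound_speed_def q_def)
  have q': "(q has_real_derivative - flat (Suc 0) \<xi>) (at \<xi>)" for \<xi>
    unfolding q_def by (auto intro!: derivative_eq_intros DERIV_flat)
  have "continuous_on UNIV (\<lambda>\<xi>. q \<xi> powr (a - 1))"
    using q q' by (intro continuous_on_powr DERIV_continuous_on continuous_on_const) (auto simp: less_imp_neq[symmetric])
  then obtain F where F: "F 0 = 0" "\<And>\<xi>. (F has_real_derivative q \<xi> powr (a - 1)) (at \<xi>)"
    using continuous_antiderivative by blast
  have F_mono: "F x \<le> F y" if "x \<le> y" for x y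
    using DERIV_nonneg_imp_nondecreasing[OF that, of F] F(2) by (meson powr_ge_zero)
  \<comment> \<open>Since \<open>q' = - flat (Suc 0)\<close> and \<open>c = q / a\<close>, the
    linear equation reads \<open>(q^a \<tau>)' = a q^(a - 1)\<close>, and \<open>F\<close>
    integrates \<open>q^(a - 1)\<close>.\<close>
  define \<tau> where "\<tau> \<xi> = a * (q \<xi> powr (- a) * F \<xi>)" for \<xi>
  have "(\<tau> has_real_derivative (1 + \<tau> \<xi> * flat (Suc 0) \<xi>) / (q \<xi> / a)) (at \<xi>)" for \<xi>
  proof -
    have "(\<tau> has_real_derivative
        a * (q \<xi> powr (- a) * q \<xi> powr (a - 1) + - a * q \<xi> powr (- a - 1) * - flat (Suc 0) \<xi> * F \<xi>)) (at \<xi>)"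
      unfolding \<tau>_def using q[of \<xi>]
      by (intro DERIV_cmult) (auto intro!: derivative_eq_intros q' F)
    moreover have "q \<xi> powr (- a) * q \<xi> powr (a - 1) = 1 / q \<xi>" "q \<xi> powr (- a - 1) = q \<xi> powr (- a) / q \<xi>"
      using q[of \<xi>] by (simp_all add: powr_minus_divide powr_diff flip: powr_add)
    ultimately show ?thesis
      using q[of \<xi>] a by (simp add: \<tau>_def field_simps)
  qed
  moreover have "1 / 2 \<le> (1 + \<tau> \<xi> * flat (Suc 0) \<xi>) / (q \<xi> / a)" for \<xi>
  proof -
    \<comment> \<open>Where \<open>\<tau>\<close> could be negative, the slope of the datum
      vanishes.\<close>
    have "\<tau> \<xi> * flat (Suc 0) \<xi> \<ge> 0"
    proof (cases "\<xi> \<le> 0")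
      case False
      then have "\<tau> \<xi> \<ge> 0"
        using F_mono[of 0 \<xi>] F(1) a by (simp add: \<tau>_def)
      then show ?thesis
        using flat_1_nonneg by simp
    qed (simp add: flat_eq_0)
    moreover have "q \<xi> / a \<le> 2"
      using q[of \<xi>] flat_0_nonneg[of \<xi>] vel_slope_pos vel_slope_less_1 mult_mono[of "q \<xi>" 2 "1 - vel_slope" 1]
      by (simp add: a_def q_def)
    ultimately have "1 / 2 * (q \<xi> / a) \<le> 1 + \<tau> \<xi> * flat (Suc 0) \<xi>"
      by linarith
    then show ?thesis
      using divide_pos_pos[OF q[of \<xi>] a] by (simp only: pos_le_divide_eq)
  qed
  moreover have "\<tau> \<xi> \<le> 0" if "\<xi> \<le> 0" for \<xi>
    using F_mono[OF that] F(1) a by (simp add: \<tau>_def mult_le_0_iff)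
  ultimately show ?thesis
    using F(1) by (intro that[of \<tau>]) (auto simp: \<tau>_def c)
qed

text \<open>Here \<open>g\<close> inverts the arrival time, whose slope of at least
  \<open>1 / 2\<close> gives the bound \<open>2 * t\<close>. The position on the characteristic from
  \<open>g t\<close> then moves with speed \<open>c + w\<close>, the fluid velocity.\<close>

lemma trajectory_foot:
  obtains g where "g 0 = 0" "\<And>t. t > 0 \<Longrightarrow> 0 < g t \<and> g t \<le> 2 * t"
    "\<And>t. t \<ge> 0 \<Longrightarrow> ((\<lambda>t. g t + t * flat 0 (g t)) has_real_derivative velocity (flat 0 (g t))) (at t)"
proof -
  obtain \<tau> where \<tau>: "\<tau> 0 = 0" "\<And>\<xi>. \<xi> \<le> 0 \<Longrightarrow> \<tau> \<xi> \<le> 0"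
    "\<And>\<xi>. (\<tau> has_real_derivative (1 + \<tau> \<xi> * flat (Suc 0) \<xi>) / sound_speed (flat 0 \<xi>)) (at \<xi>)"
    "\<And>\<xi>. 1 / 2 \<le> (1 + \<tau> \<xi> * flat (Suc 0) \<xi>) / sound_speed (flat 0 \<xi>)"
    using arrival_time by blast
  obtain g where g: "\<And>t. \<tau> (g t) = t" "\<And>\<xi>. g (\<tau> \<xi>) = \<xi>"
    "\<And>t. (g has_real_derivative inverse ((1 + \<tau> (g t) * flat (Suc 0) (g t)) / sound_speed (flat 0 (g t)))) (at t)"
    using increasing_inverse[OF \<tau>(3,4)] by (metis zero_less_divide_1_iff zero_less_numeral)
  have g0: "g 0 = 0"
    using g(2)[of 0] \<tau>(1) by simp
  have "0 < g t \<and> g t \<le> 2 * t" if "t > 0" for t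
  proof
    show "0 < g t"
      using \<tau>(2)[of "g t"] g(1)[of t] that by (cases "g t \<le> 0") auto
    show "g t \<le> 2 * t"
      using derivative_ge_imp_expanding[OF \<tau>(3,4), of "g t" 0] \<tau>(1) g(1)[of t] that by simp
  qed
  moreover have "((\<lambda>t. g t + t * flat 0 (g t)) has_real_derivative velocity (flat 0 (g t))) (at t)"
    if "t \<ge> 0" for t
  proof -
    define J where "J = 1 + t * flat (Suc 0) (g t)"
    define g' where "g' = sound_speed (flat 0 (g t)) / J"
    have "J > 0"
      using that flat_1_nonneg[of "g t"] by (simp add: J_def add_pos_nonneg)
    have g': "(g has_real_derivative g') (at t)"
      using g(3)[of t] by (simp add: g(1) g'_def J_def)
    have "((\<lambda>t. g t + t * flat 0 (g t)) has_real_derivative g' + (t * (flat (Suc 0) (g t) * g') + flat 0 (g t))) (at t)"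
      by (auto intro!: derivative_eq_intros g' DERIV_chain2[OF DERIV_flat g'])
    moreover have "g' + (t * (flat (Suc 0) (g t) * g') + flat 0 (g t)) = J * g' + flat 0 (g t)"
      by (simp add: J_def algebra_simps)
    moreover have "J * g' = sound_speed (flat 0 (g t))"
      using \<open>J > 0\<close> by (simp add: g'_def)
    ultimately show ?thesis
      using velocity_minus_sound_speed[of "flat 0 (g t)"] by (simp only: diff_eq_eq add.commute)
  qed
  ultimately show ?thesis
    using g0 that by blast
qed

text \<open>The deviation from the uniform motion of the state \<open>w = 0\<close> is positive but flat at \<open>t = 0\<close>.\<close>

lemma nonanalytic_trajectory:
  assumes "T > 0"
  obtains X where "lagrangian_trajectory T wave_velocity 0 X" "\<not> analytic_at_0 X"
proof -
  obtain g where g: "g 0 = 0" "\<And>t. t > 0 \<Longrightarrow> 0 < g t \<and> g t \<le> 2 * t"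
    "\<And>t. t \<ge> 0 \<Longrightarrow> ((\<lambda>t. g t + t * flat 0 (g t)) has_real_derivative velocity (flat 0 (g t))) (at t)"
    using trajectory_foot by blast
  define y where "y t = g t + t * flat 0 (g t)" for t
  define X where "X t = y t *\<^sub>R (axis 1 1 :: real ^ 2)" for t
  have y: "(y has_real_derivative velocity (flat 0 (g t))) (at t)" if "t \<ge> 0" for t
    using g(3)[OF that] by (simp add: y_def[abs_def])
  have X1: "X t $ 1 = y t" for t
    by (simp add: X_def axis_def)
  have "lagrangian_trajectory T wave_velocity 0 X"
    unfolding lagrangian_trajectory_def
  proof (intro conjI ballI)
    show "X 0 = 0"
      by (simp add: X_def y_def g)
    fix t
    assume "t \<in> {0..T}"
    then have "t \<ge> 0"
      by simp
    then have "burgers (X t $ 1) t = flat 0 (g t)"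
      by (simp add: X1 burgers_def y_def foot_characteristic)
    then show "(X has_vector_derivative wave_velocity (X t) t) (at t within {0..T})"
      unfolding wave_velocity_def X_def
      using y[OF \<open>t \<ge> 0\<close>] by (auto simp: X1[unfolded X_def]
          intro!: has_vector_derivative_scaleR_const has_field_derivative_at_within)
  qed
  moreover have "\<not> analytic_at_0 X"
  proof
    assume "analytic_at_0 X"
    then obtain \<eta> a where "\<eta> > 0" and a: "\<forall>t\<in>{0..<\<eta>}. (\<lambda>n. t ^ n *\<^sub>R a n) sums X t"
      unfolding analytic_at_0_def by blast
    \<comment> \<open>The number \<open>2 * (1 - vel_slope)\<close> is \<open>velocity 0\<close>.
      Subtracting the uniform motion changes only the coefficient of index \<open>1\<close>.\<close>
    define Z where "Z t = y t - 2 * (1 - vel_slope) * t" for t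
    define b where "b n = a n $ 1 - (if n = 1 then 2 * (1 - vel_slope) else 0)" for n
    have sums: "(\<lambda>n. b n * t ^ n) sums Z t" if "0 < t" "t < \<eta>" for t
    proof -
      have "(\<lambda>n. (t ^ n *\<^sub>R a n) $ 1) sums (X t $ 1)"
        using a that by (intro bounded_linear.sums[OF bounded_linear_vec_nth]) auto
      from sums_diff[OF this sums_single[of 1 "\<lambda>n. 2 * (1 - vel_slope) * t ^ n"]]
      have "(\<lambda>n. (t ^ n *\<^sub>R a n) $ 1 - (if n = 1 then 2 * (1 - vel_slope) * t ^ n else 0)) sums Z t"
        by (simp add: X1 Z_def)
      also have "(\<lambda>n. (t ^ n *\<^sub>R a n) $ 1 - (if n = 1 then 2 * (1 - vel_slope) * t ^ n else 0)) = (\<lambda>n. b n * t ^ n)"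
        by (auto simp: fun_eq_iff b_def algebra_simps)
      finally show ?thesis .
    qed
    \<comment> \<open>The mean value theorem yields one formula that serves both for the flatness of
      \<open>Z\<close> and for its positivity.\<close>
    have Z_eq: "\<exists>z. 0 < z \<and> z < t \<and> Z t = t * (vel_slope * flat 0 (g z))" if "0 < t" for t
    proof -
      have "(Z has_real_derivative vel_slope * flat 0 (g z)) (at z)" if "z \<ge> 0" for z
        unfolding Z_def using y[OF that] by (auto intro!: derivative_eq_intros simp: velocity_def)
      from MVT2[OF \<open>0 < t\<close>, of Z "\<lambda>z. vel_slope * flat 0 (g z)", OF this] show ?thesis
        by (auto simp: Z_def y_def g(1))
    qed
    have "b n = 0" for n
    proof (rule flat_power_series_eq_0[OF \<open>\<eta> > 0\<close> sums])
      fix n :: nat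
      \<comment> \<open>In the constant, \<open>\<eta>\<close> bounds the factor \<open>t\<close>,
        \<open>fact n\<close> comes from \<open>flat_bound\<close>, and \<open>2 ^ n\<close> from
        \<open>g z \<le> 2 * z\<close>.\<close>
      have "\<bar>Z t\<bar> \<le> (\<eta> * (fact n * 2 ^ n)) * t ^ n" if t: "0 < t" "t < \<eta>" for t
      proof -
        obtain z where z: "0 < z" "z < t" "Z t = t * (vel_slope * flat 0 (g z))"
          using Z_eq[OF t(1)] by blast
        have "vel_slope * flat 0 (g z) \<le> 1 * (fact n * g z ^ n)"
          using vel_slope_less_1 flat_bound[of "g z" n] flat_0_nonneg g(2)[OF z(1)] by (intro mult_mono) auto
        also have "\<dots> \<le> fact n * (2 * t) ^ n"
          unfolding mult_1 using g(2)[OF z(1)] z by (intro mult_left_mono power_mono) auto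
        finally have "t * (vel_slope * flat 0 (g z)) \<le> \<eta> * (fact n * (2 * t) ^ n)"
          using t vel_slope_pos flat_0_nonneg[of "g z"] by (intro mult_mono[OF less_imp_le[OF t(2)]]) auto
        moreover have "Z t \<ge> 0"
          using z t vel_slope_pos flat_0_nonneg[of "g z"] by simp
        ultimately show ?thesis
          using z(3) by (simp add: power_mult_distrib mult_ac)
      qed
      then show "\<exists>C. \<forall>t. 0 < t \<and> t < \<eta> \<longrightarrow> \<bar>Z t\<bar> \<le> C * t ^ n"
        by blast
    qed
    \<comment> \<open>A vanishing series contradicts the positivity of \<open>Z\<close> at any
      interior point, here the midpoint.\<close>
    then have "Z (\<eta> / 2) = 0"
      using sums[of "\<eta> / 2"] \<open>\<eta> > 0\<close> sums_unique2[OF _ sums_zero] by auto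
    moreover obtain z where "0 < z" "Z (\<eta> / 2) = \<eta> / 2 * (vel_slope * flat 0 (g z))"
      using Z_eq[of "\<eta> / 2"] \<open>\<eta> > 0\<close> by auto
    ultimately show False
      using \<open>\<eta> > 0\<close> vel_slope_pos g(2)[of z] flat_0_pos_iff[of "g z"] by simp
  qed
  ultimately show ?thesis
    using that by blast
qed

end

theorem theorem5p5:
  fixes A \<gamma> :: real
  assumes "A > 0" and "\<gamma> > 1"
  shows "\<exists>(\<rho>\<^sub>0 :: real ^ 2 \<Rightarrow> real) (u\<^sub>0 :: real ^ 2 \<Rightarrow> real ^ 2).
           smooth_on \<rho>\<^sub>0 UNIV \<and> smooth_on u\<^sub>0 UNIV \<and> (\<forall>x. \<rho>\<^sub>0 x > 0) \<and>
           (\<exists>T>0. \<exists>\<rho> u.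
              smooth_euler_solution (\<lambda>r. A * r powr \<gamma>) T \<rho> u \<and>
              (\<forall>x. \<rho> x 0 = \<rho>\<^sub>0 x \<and> u x 0 = u\<^sub>0 x) \<and>
              (\<exists>\<alpha> X. lagrangian_trajectory T u \<alpha> X \<and> \<not> analytic_at_0 X))"
proof -
  let ?\<rho> = "wave_density A \<gamma>" and ?u = "wave_velocity \<gamma>"
  have "smooth_on (\<lambda>x. ?\<rho> x 0) UNIV" "smooth_on (\<lambda>x. ?u x 0) UNIV"
    using smooth_on_initial[OF Ck_on_density[OF assms]] smooth_on_initial[OF Ck_on_velocity[OF assms]]
    by (simp_all add: wave_density_def[OF assms] wave_velocity_def[OF assms])
  moreover have "\<forall>x. ?\<rho> x 0 > 0"
    by (simp add: wave_density_def[OF assms] density_pos[OF assms] burgers_less_2)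
  \<comment> \<open>The wave is a solution for every positive \<open>T\<close>; the value
    \<open>1\<close> is an arbitrary choice.\<close>
  moreover have "smooth_euler_solution (\<lambda>r. A * r powr \<gamma>) 1 ?\<rho> ?u"
    by (simp add: smooth_euler_solution_wave[OF assms])
  moreover obtain X where "lagrangian_trajectory 1 ?u 0 X" "\<not> analytic_at_0 X"
    using nonanalytic_trajectory[OF assms, of 1] by auto
  ultimately show ?thesis
    using zero_less_one by blast
qed

end
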